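(* Let $G$ be a finite abelian group, $H$ a subgroup of $G$, and $\alpha$ an involutory automorphism of $G$. Then there exists a generalized Cayley subset $S$ of $G$ induced by $\alpha$ such that $H$ is a perfect code of $GC(G,S,\alpha)$ if and only if $\alpha(H)=H$ and, for every $g\in G\setminus H$ with $\alpha(g)g\in H$, there exists $h\in H$ such that $hg\in\Omega_\alpha(G)$.
   Context: For a finite group $G$ with identity $e$, an involutory automorphism is $\alpha\in\mathrm{Aut}(G)$ with $\alpha^2=\mathrm{id}\neq\alpha$. Set $\omega_\alpha(G)=\{\alpha(g^{-1})g\mid g\in G\}$ and $\Omega_\alpha(G)=\{g\in G\setminus\omega_\alpha(G)\mid \alpha(g)=g^{-1}\}$. A subset $S\subseteq G$ is a generalized Cayley subset of $G$ induced by $\alpha$ if $S\cap\omega_\alpha(G)=\emptyset$ and $\alpha(S)=S^{-1}$ (where $\alpha(A)=\{\alpha(a)\mid a\in A\}$, $A^{-1}=\{a^{-1}\mid a\in A\}$). The generalized Cayley graph $GC(G,S,\alpha)$ has vertex set $G$ and edge set $\{\{g,h\}\mid \alpha(g^{-1})h\in S\}$. A subset $C$ of the vertex set of a graph is a perfect code if $C$ is independent and every vertex outside $C$ is adjacent to exactly one vertex of $C$. *)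

theory Defs
  imports "HOL-Algebra.Coset"
begin

text \<open>
  Undirected graphs with unordered pairs as edges; a singleton edge would be a loop.
  Unlike the AFP digraph library, which models undirected graphs as symmetric digraphs, this keeps
  edges of the form \<open>{g, h}\<close>.
\<close>

record 'a ugraph =
  uverts :: "'a set"
  uedges :: "'a set set"

definition adjacent :: "('a, 'c) ugraph_scheme \<Rightarrow> 'a \<Rightarrow> 'a \<Rightarrow> bool" where
  "adjacent \<Gamma> u v \<longleftrightarrow> {u, v} \<in> uedges \<Gamma>"

definition independent_set :: "('a, 'c) ugraph_scheme \<Rightarrow> 'a set \<Rightarrow> bool" where
  "independent_set \<Gamma> C \<longleftrightarrow> C \<subseteq> uverts \<Gamma> \<and> (\<forall>u\<in>C. \<forall>v\<in>C. \<not> adjacent \<Gamma> u v)"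

definition perfect_code :: "('a, 'c) ugraph_scheme \<Rightarrow> 'a set \<Rightarrow> bool" where
  "perfect_code \<Gamma> C \<longleftrightarrow>
     C \<subseteq> uverts \<Gamma> \<and> independent_set \<Gamma> C \<and> (\<forall>v\<in>uverts \<Gamma> - C. \<exists>!c. c \<in> C \<and> adjacent \<Gamma> v c)"

text \<open>
  Maps between groups are total functions, so automorphisms are compared on the carrier only;
  values off the carrier are unconstrained.
\<close>

definition involutory_automorphism :: "('a, 'b) monoid_scheme \<Rightarrow> ('a \<Rightarrow> 'a) \<Rightarrow> bool" where
  "involutory_automorphism G \<alpha> \<longleftrightarrow>
     \<alpha> \<in> iso G G \<and> (\<forall>g\<in>carrier G. \<alpha> (\<alpha> g) = g) \<and> (\<exists>g\<in>carrier G. \<alpha> g \<noteq> g)"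

definition omega_set :: "('a, 'b) monoid_scheme \<Rightarrow> ('a \<Rightarrow> 'a) \<Rightarrow> 'a set" where
  "omega_set G \<alpha> = {\<alpha> (inv\<^bsub>G\<^esub> g) \<otimes>\<^bsub>G\<^esub> g | g. g \<in> carrier G}"

definition Omega_set :: "('a, 'b) monoid_scheme \<Rightarrow> ('a \<Rightarrow> 'a) \<Rightarrow> 'a set" where
  "Omega_set G \<alpha> = {g \<in> carrier G - omega_set G \<alpha>. \<alpha> g = inv\<^bsub>G\<^esub> g}"

definition gen_Cayley_subset :: "('a, 'b) monoid_scheme \<Rightarrow> ('a \<Rightarrow> 'a) \<Rightarrow> 'a set \<Rightarrow> bool" where
  "gen_Cayley_subset G \<alpha> S \<longleftrightarrow>
     S \<subseteq> carrier G \<and> S \<inter> omega_set G \<alpha> = {} \<and> \<alpha> ` S = set_inv\<^bsub>G\<^esub> S"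

definition gen_Cayley_graph :: "('a, 'b) monoid_scheme \<Rightarrow> 'a set \<Rightarrow> ('a \<Rightarrow> 'a) \<Rightarrow> 'a ugraph" where
  "gen_Cayley_graph G S \<alpha> =
     \<lparr>uverts = carrier G,
      uedges = {{g, h} | g h. g \<in> carrier G \<and> h \<in> carrier G \<and> \<alpha> (inv\<^bsub>G\<^esub> g) \<otimes>\<^bsub>G\<^esub> h \<in> S}\<rparr>"

text \<open>
  For a generalized Cayley subset the defining condition on edges is symmetric in the two
  endpoints, and there are no loops.
\<close>

lemma gen_Cayley_graph_no_loop:
  assumes "gen_Cayley_subset G \<alpha> S"
  shows "\<not> adjacent (gen_Cayley_graph G S \<alpha>) g g"
  using assms
  by (auto simp: adjacent_def gen_Cayley_graph_def gen_Cayley_subset_def omega_set_def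
      doubleton_eq_iff)

lemma gen_Cayley_cond_sym:
  assumes "group G" "involutory_automorphism G \<alpha>" "gen_Cayley_subset G \<alpha> S"
    and g: "g \<in> carrier G" and h: "h \<in> carrier G" and S: "\<alpha> (inv\<^bsub>G\<^esub> g) \<otimes>\<^bsub>G\<^esub> h \<in> S"
  shows "\<alpha> (inv\<^bsub>G\<^esub> h) \<otimes>\<^bsub>G\<^esub> g \<in> S"
proof -
  interpret group G by fact
  have hom: "\<alpha> \<in> hom G G" and invol: "\<And>x. x \<in> carrier G \<Longrightarrow> \<alpha> (\<alpha> x) = x"
    using assms(2) by (auto simp: involutory_automorphism_def iso_def)
  interpret group_hom G G \<alpha>
    using hom by unfold_locales
  have "\<alpha> (\<alpha> (inv\<^bsub>G\<^esub> g) \<otimes>\<^bsub>G\<^esub> h) \<in> set_inv\<^bsub>G\<^esub> S"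
    using assms(3) S by (auto simp: gen_Cayley_subset_def)
  moreover have "\<alpha> (\<alpha> (inv\<^bsub>G\<^esub> g) \<otimes>\<^bsub>G\<^esub> h) = inv\<^bsub>G\<^esub> g \<otimes>\<^bsub>G\<^esub> \<alpha> h"
    using g h invol[of "inv\<^bsub>G\<^esub> g"] hom_mult[of "\<alpha> (inv\<^bsub>G\<^esub> g)" h] by simp
  ultimately obtain s where s: "s \<in> S" "inv\<^bsub>G\<^esub> g \<otimes>\<^bsub>G\<^esub> \<alpha> h = inv\<^bsub>G\<^esub> s"
    by (auto simp: SET_INV_def)
  have "s \<in> carrier G"
    using s assms(3) by (auto simp: gen_Cayley_subset_def)
  then have "s = inv\<^bsub>G\<^esub> (inv\<^bsub>G\<^esub> g \<otimes>\<^bsub>G\<^esub> \<alpha> h)"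
    using s by simp
  also have "\<dots> = \<alpha> (inv\<^bsub>G\<^esub> h) \<otimes>\<^bsub>G\<^esub> g"
    using g h by (simp add: inv_mult_group)
  finally show ?thesis using s by simp
qed

lemma adjacent_gen_Cayley_graph_iff:
  assumes "group G" "involutory_automorphism G \<alpha>" "gen_Cayley_subset G \<alpha> S"
    and "g \<in> carrier G" "h \<in> carrier G"
  shows "adjacent (gen_Cayley_graph G S \<alpha>) g h \<longleftrightarrow> \<alpha> (inv\<^bsub>G\<^esub> g) \<otimes>\<^bsub>G\<^esub> h \<in> S"
  using assms(4,5) gen_Cayley_cond_sym[OF assms(1-3)]
  unfolding adjacent_def gen_Cayley_graph_def by (auto simp: doubleton_eq_iff)

end

theory Submission
  imports Defs
begin

text \<open>
  Put \<open>\<beta> x = inv (\<alpha> x)\<close>, an involution of the abelian group \<open>G\<close>. When \<open>\<alpha> ` H = H\<close>, the subgroup \<open>H\<close>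
  is a perfect code exactly when \<open>S\<close> is a transversal of the nontrivial cosets of \<open>H\<close>, and a
  generalized Cayley subset is a \<open>\<beta>\<close>-invariant set avoiding \<open>omega_set G \<alpha>\<close>; every element of
  \<open>omega_set G \<alpha>\<close> is fixed by \<open>\<beta>\<close>. An invariant transversal meets each coset fixed by \<open>\<beta>\<close> in a fixed point of \<open>\<beta>\<close>, i.e.
  in an element of \<open>Omega_set G \<alpha>\<close>; conversely, choosing such points in the fixed cosets and a pair
  \<open>x, \<beta> x\<close> for every pair of cosets swapped by \<open>\<beta>\<close> gives an invariant transversal.
\<close>

text \<open>By \<open>cong\<close>, \<open>\<beta>\<close> acts on the classes of \<open>q\<close>,
  with orbits of one or two classes. One representative per orbit, together with its image,
  suffices: in a two-class orbit the two points lie in different classes, in a one-class orbit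
  \<open>fixpoint\<close> lets them coincide.\<close>

lemma involution_invariant_transversal:
  fixes q :: "'a \<Rightarrow> 'c"
  assumes closed: "\<And>x. x \<in> A \<Longrightarrow> \<beta> x \<in> A"
    and invol: "\<And>x. x \<in> A \<Longrightarrow> \<beta> (\<beta> x) = x"
    and cong: "\<And>x y. \<lbrakk>x \<in> A; y \<in> A; q x = q y\<rbrakk> \<Longrightarrow> q (\<beta> x) = q (\<beta> y)"
    and fixpoint: "\<And>x. \<lbrakk>x \<in> A; q (\<beta> x) = q x\<rbrakk> \<Longrightarrow> \<exists>y\<in>A. q y = q x \<and> \<beta> y = y \<and> Q y"
  obtains S where "S \<subseteq> A" "\<beta> ` S = S"
    "\<And>x. x \<in> A \<Longrightarrow> \<exists>!s. s \<in> S \<and> q s = q x"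
    "\<And>s. \<lbrakk>s \<in> S; \<beta> s = s\<rbrakk> \<Longrightarrow> Q s"
proof -
  \<comment> \<open>\<open>K x\<close> is the orbit of the class of \<open>x\<close>.
    \<open>P k y\<close> makes \<open>y\<close> an admissible representative of the orbit
    \<open>k\<close>; the extra demand applies only when that orbit is a single class.\<close>
  define K where "K x = {q x, q (\<beta> x)}" for x
  define P where "P k y \<longleftrightarrow> y \<in> A \<and> K y = k \<and> (q (\<beta> y) = q y \<longrightarrow> \<beta> y = y \<and> Q y)" for k y
  \<comment> \<open>The representative depends on \<open>x\<close> only through the orbit \<open>K x\<close>; this gives uniqueness.\<close>
  define r where "r x = (SOME y. P (K x) y)" for x
  have r: "P (K x) (r x)" if "x \<in> A" for x
    unfolding r_def
  proof (rule someI_ex, cases "q (\<beta> x) = q x")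
    case True
    then obtain y where y: "y \<in> A" "q y = q x" "\<beta> y = y" "Q y"
      using fixpoint \<open>x \<in> A\<close> by blast
    then have "P (K x) y"
      using True unfolding P_def K_def by simp
    then show "\<exists>y. P (K x) y" ..
  next
    case False
    then have "P (K x) x"
      using \<open>x \<in> A\<close> unfolding P_def by simp
    then show "\<exists>y. P (K x) y" ..
  qed
  have rA: "r x \<in> A" and Kr: "K (r x) = K x"
    and rfix: "q (\<beta> (r x)) = q (r x) \<Longrightarrow> \<beta> (r x) = r x \<and> Q (r x)" if "x \<in> A" for x
    using r[OF that] unfolding P_def by auto
  have K\<beta>: "K (\<beta> x) = K x" if "x \<in> A" for x
    using invol[OF that] unfolding K_def by auto
  define S where "S = r ` A \<union> \<beta> ` r ` A"
  have S_cases: "\<exists>x\<in>A. (s = r x \<or> s = \<beta> (r x)) \<and> K s = K x" if "s \<in> S" for s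
    using that rA Kr K\<beta> unfolding S_def by fastforce
  show thesis
  proof (rule that)
    show "S \<subseteq> A"
      using rA closed unfolding S_def by auto
    have "\<beta> ` \<beta> ` r ` A = r ` A"
      using rA invol by (force simp: image_image)
    then show "\<beta> ` S = S"
      unfolding S_def image_Un by blast
    \<comment> \<open>If a fixed point \<open>s\<close> equals \<open>\<beta> (r x)\<close>,
      applying \<open>\<beta>\<close> gives \<open>s = r x\<close>, so \<open>rfix\<close> covers
      both forms of \<open>s\<close>.\<close>
    show "Q s" if "s \<in> S" "\<beta> s = s" for s
      using S_cases[OF that(1)] that(2) rfix invol rA by metis
    show "\<exists>!s. s \<in> S \<and> q s = q x" if x: "x \<in> A" for x
    proof (rule ex_ex1I)
      have "q x \<in> K (r x)"
        using Kr[OF x] unfolding K_def by simp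
      moreover have "r x \<in> S" "\<beta> (r x) \<in> S"
        using x unfolding S_def by auto
      ultimately show "\<exists>s. s \<in> S \<and> q s = q x"
        unfolding K_def by auto
    next
      fix s t assume st: "s \<in> S \<and> q s = q x" "t \<in> S \<and> q t = q x"
      obtain y where y: "y \<in> A" "s = r y \<or> s = \<beta> (r y)" "K s = K y"
        using S_cases st by blast
      obtain z where z: "z \<in> A" "t = r z \<or> t = \<beta> (r z)" "K t = K z"
        using S_cases st by blast
      have "s \<in> A" "t \<in> A"
        using y z rA closed by auto
      then have "K s = K t"
        using cong[of s t] st unfolding K_def by simp
      then have "r y = r z"
        using y z unfolding r_def by simp
      \<comment> \<open>Both points lie in \<open>{r y, \<beta> (r y)}\<close>. If one is
        \<open>r y\<close> and the other its image, then \<open>q s = q t\<close> makes the orbit a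
        single class, and there \<open>rfix\<close> gives
        \<open>\<beta> (r y) = r y\<close>.\<close>
      then show "s = t"
        using y z st rfix by metis
    qed
  qed
qed

locale involutory_group = group G for G (structure) +
  fixes \<alpha> H
  assumes involutory: "involutory_automorphism G \<alpha>"
    and H: "subgroup H G"
begin

lemma invol: "x \<in> carrier G \<Longrightarrow> \<alpha> (\<alpha> x) = x"
  using involutory by (auto simp: involutory_automorphism_def)

sublocale \<alpha>: group_hom G G \<alpha>
  using involutory by unfold_locales (auto simp: involutory_automorphism_def iso_def)

lemma perfect_code_iff:
  assumes "gen_Cayley_subset G \<alpha> S"
  shows "perfect_code (gen_Cayley_graph G S \<alpha>) H \<longleftrightarrow>
    (\<forall>h\<in>H. \<forall>k\<in>H. \<alpha> (inv h) \<otimes> k \<notin> S) \<and>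
    (\<forall>v\<in>carrier G - H. \<exists>!h. h \<in> H \<and> \<alpha> (inv h) \<otimes> v \<in> S)"
proof -
  have verts: "uverts (gen_Cayley_graph G S \<alpha>) = carrier G"
    by (simp add: gen_Cayley_graph_def)
  have adj: "adjacent (gen_Cayley_graph G S \<alpha>) g h \<longleftrightarrow> \<alpha> (inv g) \<otimes> h \<in> S"
    "adjacent (gen_Cayley_graph G S \<alpha>) g h \<longleftrightarrow> \<alpha> (inv h) \<otimes> g \<in> S"
    if "g \<in> carrier G" "h \<in> carrier G" for g h
    using that adjacent_gen_Cayley_graph_iff[OF is_group involutory assms]
      gen_Cayley_cond_sym[OF is_group involutory assms] by blast+
  have "(h \<in> H \<and> adjacent (gen_Cayley_graph G S \<alpha>) v h) \<longleftrightarrow> (h \<in> H \<and> \<alpha> (inv h) \<otimes> v \<in> S)"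
    if "v \<in> carrier G" for v h
    using adj(2) that subgroup.mem_carrier[OF H] by blast
  then show ?thesis
    using subgroup.subset[OF H] adj(1) subgroup.mem_carrier[OF H]
    unfolding perfect_code_def independent_set_def verts by auto
qed

lemma perfect_code_imp_invariant:
  assumes S: "gen_Cayley_subset G \<alpha> S" and "perfect_code (gen_Cayley_graph G S \<alpha>) H"
  shows "\<alpha> ` H = H"
proof -
  note pc = assms(2)[unfolded perfect_code_iff[OF S]]
  have sub: "\<alpha> h \<in> H" if h: "h \<in> H" for h
  proof (rule ccontr)
    assume "\<alpha> h \<notin> H"
    then have "\<alpha> h \<in> carrier G - H"
      using subgroup.mem_carrier[OF H h] by simp
    then obtain k where k: "k \<in> H" "\<alpha> (inv k) \<otimes> \<alpha> h \<in> S"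
      using pc by (meson ex1_implies_ex)
    \<comment> \<open>The edge between \<open>\<alpha> h\<close> and its neighbour \<open>k\<close>
      has the same label as one between \<open>inv h \<otimes> k\<close> and \<open>\<one>\<close>,
      both in \<open>H\<close>, which contradicts independence.\<close>
    have "\<alpha> (inv (inv h \<otimes> k)) \<otimes> \<one> = \<alpha> (inv k) \<otimes> \<alpha> h"
      using h k subgroup.mem_carrier[OF H] by (simp add: inv_mult_group)
    moreover have "inv h \<otimes> k \<in> H"
      using h k H by (simp add: subgroup.m_closed subgroup.m_inv_closed)
    ultimately show False
      using bspec[OF bspec[OF conjunct1[OF pc]]] k(2) subgroup.one_closed[OF H] by metis
  qed
  show ?thesis
  proof
    show "H \<subseteq> \<alpha> ` H"
      using sub invol subgroup.mem_carrier[OF H] by (metis image_eqI subsetI)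
  qed (use sub in blast)
qed

text \<open>As \<open>h\<close> runs through \<open>H\<close>, the product
  \<open>\<alpha> (inv h) \<otimes> v\<close> runs bijectively through \<open>H #> v\<close>. Unique
  neighbours in \<open>H\<close> thus become unique elements of \<open>S\<close> in the
  coset.\<close>

lemma perfect_code_iff_transversal:
  assumes S: "gen_Cayley_subset G \<alpha> S" and inv: "\<alpha> ` H = H"
  shows "perfect_code (gen_Cayley_graph G S \<alpha>) H \<longleftrightarrow>
    S \<inter> H = {} \<and> (\<forall>v\<in>carrier G - H. \<exists>!s. s \<in> S \<and> s \<in> H #> v)"
proof -
  note mem = subgroup.mem_carrier[OF H]
  have \<alpha>H: "\<alpha> h \<in> H" if "h \<in> H" for h
    using that inv by blast
  have "(\<forall>h\<in>H. \<forall>k\<in>H. \<alpha> (inv h) \<otimes> k \<notin> S) \<longleftrightarrow> S \<inter> H = {}"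
  proof
    assume *: "\<forall>h\<in>H. \<forall>k\<in>H. \<alpha> (inv h) \<otimes> k \<notin> S"
    have "k \<notin> S" if "k \<in> H" for k
      using *[rule_format, OF subgroup.one_closed[OF H] that] mem[OF that] by simp
    then show "S \<inter> H = {}" by blast
  next
    assume "S \<inter> H = {}"
    moreover have "\<alpha> (inv h) \<otimes> k \<in> H" if "h \<in> H" "k \<in> H" for h k
      using that \<alpha>H H by (meson subgroup.m_closed subgroup.m_inv_closed)
    ultimately show "\<forall>h\<in>H. \<forall>k\<in>H. \<alpha> (inv h) \<otimes> k \<notin> S" by blast
  qed
  moreover have "(\<exists>!h. h \<in> H \<and> \<alpha> (inv h) \<otimes> v \<in> S) \<longleftrightarrow> (\<exists>!s. s \<in> S \<and> s \<in> H #> v)"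
    if v: "v \<in> carrier G" for v
  proof -
    have coset: "H #> v = (\<lambda>h. \<alpha> (inv h) \<otimes> v) ` H"
    proof -
      have "(\<lambda>h. \<alpha> (inv h)) ` H = H"
      proof
        show "(\<lambda>h. \<alpha> (inv h)) ` H \<subseteq> H"
          using \<alpha>H subgroup.m_inv_closed[OF H] by blast
        show "H \<subseteq> (\<lambda>h. \<alpha> (inv h)) ` H"
        proof
          fix h assume h: "h \<in> H"
          then have "inv (\<alpha> h) \<in> H" "h = \<alpha> (inv (inv (\<alpha> h)))"
            using \<alpha>H subgroup.m_inv_closed[OF H] mem invol by auto
          then show "h \<in> (\<lambda>h. \<alpha> (inv h)) ` H" by blast
        qed
      qed
      then have "H #> v = (\<lambda>h. h \<otimes> v) ` (\<lambda>h. \<alpha> (inv h)) ` H"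
        by (auto simp: r_coset_def)
      then show ?thesis
        by (simp add: image_image)
    qed
    have inj: "h = k" if "h \<in> H" "k \<in> H" "\<alpha> (inv h) \<otimes> v = \<alpha> (inv k) \<otimes> v" for h k
    proof -
      have "\<alpha> (inv h) = \<alpha> (inv k)"
        using that v mem by simp
      then have "inv h = inv k"
        using that mem invol by (metis inv_closed)
      then show ?thesis
        using that mem by (metis inv_inv)
    qed
    show ?thesis
      unfolding coset using inj by (intro iffI; elim ex1E; intro ex_ex1I) (blast | metis (no_types, lifting) imageE)+
  qed
  ultimately show ?thesis
    unfolding perfect_code_iff[OF S] by simp
qed

lemma gen_Cayley_subset_iff:
  assumes "S \<subseteq> carrier G"
  shows "gen_Cayley_subset G \<alpha> S \<longleftrightarrow> S \<inter> omega_set G \<alpha> = {} \<and> (\<lambda>x. inv (\<alpha> x)) ` S = S"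
proof -
  have "\<alpha> ` S = set_inv S \<longleftrightarrow> (\<lambda>x. inv x) ` \<alpha> ` S = (\<lambda>x. inv x) ` (set_inv S)"
    by (rule inj_on_image_eq_iff[symmetric, where C = "carrier G"])
      (use assms in \<open>auto simp: SET_INV_def intro: inj_on_inverseI[of _ "m_inv G"]\<close>)
  moreover have "(\<lambda>x. inv x) ` (set_inv S) = S"
    using assms by (force simp: SET_INV_def)
  ultimately show ?thesis
    using assms by (simp add: gen_Cayley_subset_def image_image)
qed

text \<open>For \<open>x = \<alpha> (inv g) \<otimes> g\<close>, applying \<open>\<alpha>\<close>
  gives \<open>inv g \<otimes> \<alpha> g\<close>, whose inverse is \<open>x\<close> again. Hence
  only the fixed points in an invariant set have to be kept out of
  \<open>omega_set G \<alpha>\<close>.\<close>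

lemma omega_set_inverted:
  assumes "x \<in> omega_set G \<alpha>"
  shows "inv (\<alpha> x) = x"
  using assms invol by (auto simp: omega_set_def inv_mult_group)

lemma Omega_set_iff:
  assumes "x \<in> carrier G"
  shows "x \<in> Omega_set G \<alpha> \<longleftrightarrow> x \<notin> omega_set G \<alpha> \<and> inv (\<alpha> x) = x"
  using assms by (auto simp: Omega_set_def) (metis \<alpha>.hom_closed inv_inv)

end

theorem theorem2p17:
  fixes G :: "('a, 'b) monoid_scheme" (structure) and H :: "'a set" and \<alpha> :: "'a \<Rightarrow> 'a"
  assumes "comm_group G" and "finite (carrier G)"
    and "subgroup H G"
    and "involutory_automorphism G \<alpha>"
  shows "(\<exists>S. gen_Cayley_subset G \<alpha> S \<and> perfect_code (gen_Cayley_graph G S \<alpha>) H) \<longleftrightarrow>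
    \<alpha> ` H = H \<and>
    (\<forall>g\<in>carrier G - H. \<alpha> g \<otimes> g \<in> H \<longrightarrow> (\<exists>h\<in>H. h \<otimes> g \<in> Omega_set G \<alpha>))"
proof -
  interpret comm_group G by fact
  interpret involutory_group G \<alpha> H
    using assms is_group by (intro involutory_group.intro involutory_group_axioms.intro)
  note mem = subgroup.mem_carrier[OF H]
  define \<beta> where "\<beta> x = inv (\<alpha> x)" for x
  have \<beta>_closed: "\<beta> x \<in> carrier G" and \<beta>_invol: "\<beta> (\<beta> x) = x" if "x \<in> carrier G" for x
    using that invol by (auto simp: \<beta>_def)
  have \<beta>_mult: "\<beta> (x \<otimes> y) = \<beta> x \<otimes> \<beta> y" if "x \<in> carrier G" "y \<in> carrier G" for x y
    using that by (simp add: \<beta>_def inv_mult)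
  have coset_eq: "H #> x = H #> y \<longleftrightarrow> x \<in> H #> y" if "x \<in> carrier G" "y \<in> carrier G" for x y
    using that H by (metis repr_independence rcos_self)
  have \<beta>_coset: "\<beta> x \<in> H #> \<beta> y"
    if inv: "\<alpha> ` H = H" and x: "x \<in> H #> y" and y: "y \<in> carrier G" for x y
  proof -
    obtain h where h: "h \<in> H" "x = h \<otimes> y"
      using x by (auto simp: r_coset_def)
    have "\<beta> h \<in> H"
      using h inv subgroup.m_inv_closed[OF H] unfolding \<beta>_def by blast
    then show ?thesis
      using h \<beta>_mult mem y by (auto simp: r_coset_def)
  qed
  \<comment> \<open>This explains the condition on \<open>g\<close> in the theorem: it singles out
    the cosets that \<open>\<beta>\<close> maps to themselves.\<close>
  have \<beta>_fixed_coset: "\<beta> x \<in> H #> x \<longleftrightarrow> \<alpha> x \<otimes> x \<in> H" if x: "x \<in> carrier G" for x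
  proof -
    have "\<beta> x \<in> H #> x \<longleftrightarrow> x \<in> H #> \<beta> x"
      using x \<beta>_closed coset_eq by metis
    also have "\<dots> \<longleftrightarrow> x \<otimes> inv (\<beta> x) \<in> H"
      using subgroup.rcos_module[OF H is_group] x \<beta>_closed by blast
    also have "x \<otimes> inv (\<beta> x) = \<alpha> x \<otimes> x"
      using x by (simp add: \<beta>_def m_comm)
    finally show ?thesis .
  qed
  show ?thesis
  proof (intro iffI conjI ballI impI; (elim exE conjE)?)
    fix S assume "gen_Cayley_subset G \<alpha> S" "perfect_code (gen_Cayley_graph G S \<alpha>) H"
    then show "\<alpha> ` H = H" by (rule perfect_code_imp_invariant)
  next
    fix S g assume S: "gen_Cayley_subset G \<alpha> S" and pc: "perfect_code (gen_Cayley_graph G S \<alpha>) H"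
      and g: "g \<in> carrier G - H" and "\<alpha> g \<otimes> g \<in> H"
    have inv: "\<alpha> ` H = H"
      using S pc by (rule perfect_code_imp_invariant)
    have SG: "S \<subseteq> carrier G"
      using S by (simp add: gen_Cayley_subset_def)
    have S\<omega>: "S \<inter> omega_set G \<alpha> = {}" and S\<beta>: "\<beta> ` S = S"
      using S unfolding gen_Cayley_subset_iff[OF SG] \<beta>_def by auto
    have ex1: "\<exists>!s. s \<in> S \<and> s \<in> H #> g"
      using pc g unfolding perfect_code_iff_transversal[OF S inv] by blast
    then obtain s where s: "s \<in> S" "s \<in> H #> g" by blast
    have "\<beta> g \<in> H #> g"
      using \<beta>_fixed_coset \<open>\<alpha> g \<otimes> g \<in> H\<close> g by blast
    then have "\<beta> s \<in> H #> g"
      using \<beta>_coset[OF inv s(2)] g coset_eq \<beta>_closed by auto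
    \<comment> \<open>By invariance of \<open>S\<close>, both \<open>s\<close> and
      \<open>\<beta> s\<close> are elements of \<open>S\<close> in \<open>H #> g\<close>, which
      contains only one.\<close>
    then have "\<beta> s = s"
      using ex1 s S\<beta> by blast
    then have "s \<in> Omega_set G \<alpha>"
      using s SG S\<omega> Omega_set_iff unfolding \<beta>_def by blast
    then show "\<exists>h\<in>H. h \<otimes> g \<in> Omega_set G \<alpha>"
      using s by (auto simp: r_coset_def)
  next
    assume inv: "\<alpha> ` H = H"
      and \<Omega>: "\<forall>g\<in>carrier G - H. \<alpha> g \<otimes> g \<in> H \<longrightarrow> (\<exists>h\<in>H. h \<otimes> g \<in> Omega_set G \<alpha>)"
    have \<beta>H: "\<beta> x \<in> H" if "x \<in> H" for x
      using that inv subgroup.m_inv_closed[OF H] unfolding \<beta>_def by blast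
    \<comment> \<open>The classes are the cosets other than \<open>H\<close>; a coset fixed by
      \<open>\<beta>\<close> gets its fixed point outside \<open>omega_set G \<alpha>\<close> from
      \<open>\<Omega>\<close>.\<close>
    obtain S where S: "S \<subseteq> carrier G - H" "\<beta> ` S = S"
      and ex1: "\<And>x. x \<in> carrier G - H \<Longrightarrow> \<exists>!s. s \<in> S \<and> H #> s = H #> x"
      and fixed: "\<And>s. \<lbrakk>s \<in> S; \<beta> s = s\<rbrakk> \<Longrightarrow> s \<notin> omega_set G \<alpha>"
    proof (rule involution_invariant_transversal
        [of "carrier G - H" \<beta> "\<lambda>x. H #> x" "\<lambda>x. x \<notin> omega_set G \<alpha>"])
      show "\<beta> x \<in> carrier G - H" if "x \<in> carrier G - H" for x
        using that \<beta>_closed \<beta>_invol \<beta>H by (metis DiffD1 DiffD2 DiffI)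
      show "\<beta> (\<beta> x) = x" if "x \<in> carrier G - H" for x
        using that \<beta>_invol by blast
      show "H #> \<beta> x = H #> \<beta> y"
        if "x \<in> carrier G - H" "y \<in> carrier G - H" "H #> x = H #> y" for x y
        using that \<beta>_coset[OF inv, of x y] coset_eq \<beta>_closed by simp
      show "\<exists>y\<in>carrier G - H. H #> y = H #> x \<and> \<beta> y = y \<and> y \<notin> omega_set G \<alpha>"
        if x: "x \<in> carrier G - H" "H #> \<beta> x = H #> x" for x
      proof -
        have "\<alpha> x \<otimes> x \<in> H"
          using x \<beta>_fixed_coset coset_eq \<beta>_closed by simp
        then obtain h where h: "h \<in> H" "h \<otimes> x \<in> Omega_set G \<alpha>"
          using \<Omega> x by blast
        have hx: "h \<otimes> x \<in> carrier G" "h \<otimes> x \<in> H #> x"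
          using h x mem by (auto simp: r_coset_def)
        have "h \<otimes> x \<notin> H"
        proof
          assume "h \<otimes> x \<in> H"
          then have "inv h \<otimes> (h \<otimes> x) \<in> H"
            using h H by (meson subgroup.m_closed subgroup.m_inv_closed)
          then show False
            using h x mem by (simp add: m_assoc[symmetric])
        qed
        then show ?thesis
          using h hx x coset_eq Omega_set_iff unfolding \<beta>_def by blast
      qed
    qed (use that in blast)
    have SG: "S \<subseteq> carrier G"
      using S by blast
    \<comment> \<open>A common element would be fixed by \<open>\<beta>\<close>, and
      \<open>fixed\<close> excludes such points from \<open>omega_set G \<alpha>\<close>.\<close>
    have "S \<inter> omega_set G \<alpha> = {}"
      using fixed omega_set_inverted unfolding \<beta>_def by blast
    then have gen: "gen_Cayley_subset G \<alpha> S"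
      using S unfolding gen_Cayley_subset_iff[OF SG] \<beta>_def by simp
    have "\<exists>!s. s \<in> S \<and> s \<in> H #> v" if v: "v \<in> carrier G - H" for v
    proof -
      have "s \<in> S \<and> s \<in> H #> v \<longleftrightarrow> s \<in> S \<and> H #> s = H #> v" for s
        using coset_eq SG v by blast
      then show ?thesis
        using ex1[OF v] by simp
    qed
    then have "perfect_code (gen_Cayley_graph G S \<alpha>) H"
      using S unfolding perfect_code_iff_transversal[OF gen inv] by blast
    then show "\<exists>S. gen_Cayley_subset G \<alpha> S \<and> perfect_code (gen_Cayley_graph G S \<alpha>) H"
      using gen by blast
  qed
qed

end
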